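(* Let $f\in(\mathbb{R}_+^* )^N$ and, for $u\in\mathbb{R}^N$, let $A(u)=(a_{ij})_{i,j=1}^N\in\mathbb{R}^{N\times N}$ be the osmosis discretisation matrix defined in the context. Then: 1. the explicit scheme $u^{k+1}=(I+\tau A(u^k))u^k$, $u^0=f$, is conditionally stable, namely it is stable for $$\tau\le\frac{1}{\max\{|a_{11}|,\ldots,|a_{NN}|\}};$$ 2. the semi-implicit scheme $u^{k+1}=(I-\tau A(u^k))^{-1}u^k$, $u^0=f$, is unconditionally stable, i.e. it is stable for any $\tau>0$.
   Context: $\mathbb{R}_+^*$ is the set of positive reals. Consider a regular pixel grid of size $m_x\times m_y$ with $N=m_xm_y$ pixels and spacing $h>0$; images on the grid are identified with vectors in $\mathbb{R}^N$. Let $v\in(\mathbb{R}_+^* )^N$ be a fixed positive reference image and $0<\epsilon\ll 1$ a fixed regularisation parameter. For an image $u$, the diffusivity at pixel $(i,j)$ is $$g_{i,j}=\frac{1}{\sqrt{(s^x_{i,j})^2+(s^y_{i,j})^2+\epsilon}},\quad s^x_{i,j}=\frac{u_{i+1,j}-u_{i-1,j}}{2h}-\frac{v_{i+1,j}-v_{i-1,j}}{2h}\frac{u_{i,j}}{v_{i,j}},\quad s^y_{i,j}=\frac{u_{i,j+1}-u_{i,j-1}}{2h}-\frac{v_{i,j+1}-v_{i,j-1}}{2h}\frac{u_{i,j}}{v_{i,j}},$$ where values outside the grid are obtained by mirroring the image at the boundary. After indexing the pixels by a single index $i=1,\dots,N$, and letting $\mathcal{N}(i)$ be the set of (at most four)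 grid neighbours of pixel $i$ in the directions north, south, east, west, the matrix $A(u)\in\mathbb{R}^{N\times N}$ has entries $$a_{ij}=\begin{cases}\displaystyle\sum_{k\in\mathcal{N}(i)}\frac{g_k+g_i}{2h^2}\Big(-1-\frac{v_k-v_i}{v_k+v_i}\Big)& i=j,\\ \displaystyle\frac{g_j+g_i}{2h^2}\Big(1-\frac{v_j-v_i}{v_j+v_i}\Big)& i\ne j,\ j\in\mathcal{N}(i),\\ 0& i\neq j,\ j\notin\mathcal{N}(i).\end{cases}$$ The time step $\tau>0$ is uniform and $k=0,1,2,\ldots$. Stability means stability with respect to the $1$-norm: $\|u^k\|_1\le\|f\|_1$ for all $k\in\mathbb{N}$. The time-step restriction in the explicit case is to be understood with $a_{ii}$ the diagonal entries of $A(u^k)$, and to hold for every $k$. *)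

theory Defs
  imports
    Complex_Main
    "HOL-Library.Extended_Real"
    "Jordan_Normal_Form.Gauss_Jordan_Elimination"
begin

text \<open>
  Pixels carry two-dimensional coordinates in \<open>{1..mx} \<times> {1..my}\<close>. A map \<open>pix\<close>, required to be a
  bijection from \<open>{..<mx * my}\<close> onto this set, enumerates them by a single index, so that images
  are vectors of dimension \<open>mx * my\<close>. Vector and matrix indices start at \<open>0\<close>.
\<close>

definition grid_pixels :: "nat \<Rightarrow> nat \<Rightarrow> (nat \<times> nat) set" where
  "grid_pixels mx my = {1..mx} \<times> {1..my}"

text \<open>
  Mirroring at the boundary of the image, i.e. at the outer edge of the boundary pixels:
  coordinate \<open>0\<close> is reflected to \<open>1\<close> and \<open>m + 1\<close> to \<open>m\<close>.
\<close>

definition mirror :: "nat \<Rightarrow> nat \<Rightarrow> nat" where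
  "mirror m i = (if i = 0 then 1 else if i = m + 1 then m else i)"

definition pixel_value ::
  "nat \<Rightarrow> nat \<Rightarrow> (nat \<Rightarrow> nat \<times> nat) \<Rightarrow> real vec \<Rightarrow> nat \<Rightarrow> nat \<Rightarrow> real" where
  "pixel_value mx my pix u i j =
     u $ the_inv_into {..<mx * my} pix (mirror mx i, mirror my j)"

text \<open>
  The truncated subtraction \<open>i - 1\<close> below is only ever used for coordinates \<open>i \<ge> 1\<close>.
\<close>

definition slope_x ::
  "nat \<Rightarrow> nat \<Rightarrow> (nat \<Rightarrow> nat \<times> nat) \<Rightarrow> real \<Rightarrow> real vec \<Rightarrow> real vec \<Rightarrow> nat \<Rightarrow> nat \<Rightarrow> real" where
  "slope_x mx my pix h v u i j =
     (let U = pixel_value mx my pix u; V = pixel_value mx my pix v in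
       (U (i + 1) j - U (i - 1) j) / (2 * h)
         - (V (i + 1) j - V (i - 1) j) / (2 * h) * (U i j / V i j))"

definition slope_y ::
  "nat \<Rightarrow> nat \<Rightarrow> (nat \<Rightarrow> nat \<times> nat) \<Rightarrow> real \<Rightarrow> real vec \<Rightarrow> real vec \<Rightarrow> nat \<Rightarrow> nat \<Rightarrow> real" where
  "slope_y mx my pix h v u i j =
     (let U = pixel_value mx my pix u; V = pixel_value mx my pix v in
       (U i (j + 1) - U i (j - 1)) / (2 * h)
         - (V i (j + 1) - V i (j - 1)) / (2 * h) * (U i j / V i j))"

definition diffusivity ::
  "nat \<Rightarrow> nat \<Rightarrow> (nat \<Rightarrow> nat \<times> nat) \<Rightarrow> real \<Rightarrow> real \<Rightarrow> real vec \<Rightarrow> real vec \<Rightarrow> nat \<Rightarrow> real" where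
  "diffusivity mx my pix h eps v u k =
     (case pix k of (i, j) \<Rightarrow>
       1 / sqrt ((slope_x mx my pix h v u i j)\<^sup>2 + (slope_y mx my pix h v u i j)\<^sup>2 + eps))"

text \<open>
  For a pixel in the first row or column, \<open>x - 1\<close> or \<open>y - 1\<close> is \<open>0\<close>, which is not the coordinate
  of any pixel.
\<close>

definition grid_neighbours :: "nat \<Rightarrow> nat \<Rightarrow> (nat \<Rightarrow> nat \<times> nat) \<Rightarrow> nat \<Rightarrow> nat set" where
  "grid_neighbours mx my pix i =
     {k. k < mx * my \<and>
       (case pix i of (x, y) \<Rightarrow> pix k \<in> {(x + 1, y), (x - 1, y), (x, y + 1), (x, y - 1)})}"

definition osmosis_matrix ::
  "nat \<Rightarrow> nat \<Rightarrow> (nat \<Rightarrow> nat \<times> nat) \<Rightarrow> real \<Rightarrow> real \<Rightarrow> real vec \<Rightarrow> real vec \<Rightarrow> real mat" where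
  "osmosis_matrix mx my pix h eps v u =
     (let g = diffusivity mx my pix h eps v u; Nb = grid_neighbours mx my pix in
       mat (mx * my) (mx * my) (\<lambda>(i, j).
         if i = j then
           (\<Sum>k\<in>Nb i. (g k + g i) / (2 * h\<^sup>2) * (- 1 - (v $ k - v $ i) / (v $ k + v $ i)))
         else if j \<in> Nb i then
           (g j + g i) / (2 * h\<^sup>2) * (1 - (v $ j - v $ i) / (v $ j + v $ i))
         else 0))"

text \<open>The schemes below take the matrix-valued map \<open>A\<close> on \<open>N\<close>-dimensional vectors as argument.\<close>

primrec explicit_scheme ::
  "nat \<Rightarrow> (real vec \<Rightarrow> real mat) \<Rightarrow> real \<Rightarrow> real vec \<Rightarrow> nat \<Rightarrow> real vec" where
  "explicit_scheme N A \<tau> f 0 = f"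
| "explicit_scheme N A \<tau> f (Suc k) =
     (1\<^sub>m N + \<tau> \<cdot>\<^sub>m A (explicit_scheme N A \<tau> f k)) *\<^sub>v explicit_scheme N A \<tau> f k"

text \<open>
  The function \<open>mat_inverse\<close> returns \<open>None\<close> on singular matrices; a scheme step is meaningful only
  if \<open>1\<^sub>m N - \<tau> \<cdot>\<^sub>m A u\<close> is invertible.
\<close>

primrec semi_implicit_scheme ::
  "nat \<Rightarrow> (real vec \<Rightarrow> real mat) \<Rightarrow> real \<Rightarrow> real vec \<Rightarrow> nat \<Rightarrow> real vec" where
  "semi_implicit_scheme N A \<tau> f 0 = f"
| "semi_implicit_scheme N A \<tau> f (Suc k) =
     the (mat_inverse (1\<^sub>m N - \<tau> \<cdot>\<^sub>m A (semi_implicit_scheme N A \<tau> f k)))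
       *\<^sub>v semi_implicit_scheme N A \<tau> f k"

definition norm1_vec :: "real vec \<Rightarrow> real" where
  "norm1_vec u = (\<Sum>i<dim_vec u. \<bar>u $ i\<bar>)"

definition stable_norm1 :: "real vec \<Rightarrow> (nat \<Rightarrow> real vec) \<Rightarrow> bool" where
  "stable_norm1 f u \<longleftrightarrow> (\<forall>k. norm1_vec (u k) \<le> norm1_vec f)"

end

theory Submission
  imports Defs "Jordan_Normal_Form.Determinant"
begin

text \<open>
  For every image, the osmosis matrix is the generator of a continuous-time Markov chain acting on
  column vectors: its off-diagonal entries are nonnegative and each of its columns sums to zero
  (\<open>osmosis_matrix_generator\<close>). The columns sum to zero because the flux that leaves pixel \<open>j\<close>
  towards a neighbour \<open>k\<close>, with the weight
  \<open>1 - (v\<^sub>j - v\<^sub>k) / (v\<^sub>j + v\<^sub>k) = 1 + (v\<^sub>k - v\<^sub>j) / (v\<^sub>k + v\<^sub>j)\<close>, arrives in full at \<open>k\<close>. This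
  weight equals \<open>2 v\<^sub>k / (v\<^sub>j + v\<^sub>k)\<close> and is positive because \<open>v\<close> is; together with the
  nonnegative diffusivities it gives the sign of the off-diagonal entries.

  Both stability statements hold for any generator \<open>A\<close>, and are proved one time
  step at a time, with the matrix of the current iterate. For the explicit scheme, the time
  step restriction makes the diagonal of \<open>I + \<tau> A\<close> nonnegative. This matrix is then
  column-stochastic and hence contracts the 1-norm (\<open>column_stochastic_contracts_norm1\<close>). For the
  semi-implicit scheme, a generator is dissipative in the 1-norm: \<open>\<Sum>\<^sub>i sgn (w\<^sub>i) (A w)\<^sub>i \<le> 0\<close>. It
  follows that \<open>\<parallel>w\<parallel> \<le> \<parallel>(I - \<tau> A) w\<parallel>\<close> for every \<open>\<tau> \<ge> 0\<close>
  (\<open>norm1_le_norm1_resolvent_image\<close>). This single inequality shows both that \<open>I - \<tau> A\<close> has a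
  trivial kernel and that its inverse contracts the 1-norm.
\<close>

section \<open>Generators and the 1-norm\<close>

definition generator_mat :: "nat \<Rightarrow> real mat \<Rightarrow> bool" where
  "generator_mat n A \<longleftrightarrow> A \<in> carrier_mat n n
     \<and> (\<forall>i<n. \<forall>j<n. i \<noteq> j \<longrightarrow> 0 \<le> A $$ (i, j))
     \<and> (\<forall>j<n. (\<Sum>i<n. A $$ (i, j)) = 0)"

lemma mult_mat_vec_index_sum:
  assumes "A \<in> carrier_mat n m" "u \<in> carrier_vec m" "i < n"
  shows "(A *\<^sub>v u) $ i = (\<Sum>j<m. A $$ (i, j) * u $ j)"
  using assms by (auto simp: scalar_prod_def lessThan_atLeast0 intro!: sum.cong)

lemma norm1_vec_carrier:
  assumes "u \<in> carrier_vec n"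
  shows "norm1_vec u = (\<Sum>i<n. \<bar>u $ i\<bar>)"
  using assms by (auto simp: norm1_vec_def)

text \<open>Each \<open>\<bar>u\<^sub>j\<bar>\<close> is distributed over the rows with weights that sum to one.\<close>

lemma column_stochastic_contracts_norm1:
  assumes P: "P \<in> carrier_mat n n"
    and nonneg: "\<And>i j. i < n \<Longrightarrow> j < n \<Longrightarrow> 0 \<le> P $$ (i, j)"
    and col: "\<And>j. j < n \<Longrightarrow> (\<Sum>i<n. P $$ (i, j)) = 1"
    and u: "u \<in> carrier_vec n"
  shows "norm1_vec (P *\<^sub>v u) \<le> norm1_vec u"
proof -
  have "norm1_vec (P *\<^sub>v u) = (\<Sum>i<n. \<bar>\<Sum>j<n. P $$ (i, j) * u $ j\<bar>)"
    using P u by (subst norm1_vec_carrier[of _ n])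
      (auto simp: mult_mat_vec_index_sum[OF P u] simp del: index_mult_mat_vec)
  also have "\<dots> \<le> (\<Sum>i<n. \<Sum>j<n. P $$ (i, j) * \<bar>u $ j\<bar>)"
  proof (rule sum_mono)
    fix i assume "i \<in> {..<n}"
    then have "(\<Sum>j<n. \<bar>P $$ (i, j) * u $ j\<bar>) = (\<Sum>j<n. P $$ (i, j) * \<bar>u $ j\<bar>)"
      using nonneg by (intro sum.cong) (auto simp: abs_mult)
    then show "\<bar>\<Sum>j<n. P $$ (i, j) * u $ j\<bar> \<le> (\<Sum>j<n. P $$ (i, j) * \<bar>u $ j\<bar>)"
      using sum_abs[of "\<lambda>j. P $$ (i, j) * u $ j" "{..<n}"] by simp
  qed
  also have "\<dots> = (\<Sum>j<n. (\<Sum>i<n. P $$ (i, j)) * \<bar>u $ j\<bar>)"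
    by (subst sum.swap) (simp add: sum_distrib_right)
  also have "\<dots> = norm1_vec u"
    using col by (simp add: norm1_vec_carrier[OF u])
  finally show ?thesis .
qed

lemma explicit_step_contracts_norm1:
  assumes A: "generator_mat n A" and "0 \<le> \<tau>"
    and diag: "\<And>i. i < n \<Longrightarrow> \<tau> * \<bar>A $$ (i, i)\<bar> \<le> 1"
    and u: "u \<in> carrier_vec n"
  shows "norm1_vec ((1\<^sub>m n + \<tau> \<cdot>\<^sub>m A) *\<^sub>v u) \<le> norm1_vec u"
proof (rule column_stochastic_contracts_norm1[where n = n])
  have A': "A \<in> carrier_mat n n" using A by (simp add: generator_mat_def)
  then show "1\<^sub>m n + \<tau> \<cdot>\<^sub>m A \<in> carrier_mat n n" by simp
  show "0 \<le> (1\<^sub>m n + \<tau> \<cdot>\<^sub>m A) $$ (i, j)" if "i < n" "j < n" for i j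
  proof (cases "i = j")
    case True
    have "- \<tau> * A $$ (i, i) \<le> \<tau> * \<bar>A $$ (i, i)\<bar>"
      using mult_left_mono[of "- A $$ (i, i)" "\<bar>A $$ (i, i)\<bar>" \<tau>] \<open>0 \<le> \<tau>\<close> by simp
    then show ?thesis using diag[of i] that A' True by simp
  next
    case False
    then show ?thesis using that A A' \<open>0 \<le> \<tau>\<close> by (simp add: generator_mat_def)
  qed
  show "(\<Sum>i<n. (1\<^sub>m n + \<tau> \<cdot>\<^sub>m A) $$ (i, j)) = 1" if "j < n" for j
  proof -
    have "(\<Sum>i<n. (1\<^sub>m n + \<tau> \<cdot>\<^sub>m A) $$ (i, j))
        = (\<Sum>i<n. if i = j then 1 else 0) + \<tau> * (\<Sum>i<n. A $$ (i, j))"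
      using that A' by (simp add: sum.distrib sum_distrib_left)
    then show ?thesis using that A by (simp add: generator_mat_def)
  qed
qed (fact u)

text \<open>
  The vector of signs of \<open>w\<close> is a subgradient of the 1-norm at \<open>w\<close>. In column \<open>j\<close>, replacing every
  sign by that of \<open>w\<^sub>j\<close> keeps the diagonal term and can only increase the off-diagonal ones, and the
  resulting sum is \<open>\<bar>w\<^sub>j\<bar>\<close> times the column sum zero.
\<close>

lemma generator_mat_dissipative:
  assumes A: "generator_mat n A" and w: "w \<in> carrier_vec n"
  shows "(\<Sum>i<n. sgn (w $ i) * (A *\<^sub>v w) $ i) \<le> 0"
proof -
  have A': "A \<in> carrier_mat n n" using A by (simp add: generator_mat_def)
  have "(\<Sum>i<n. sgn (w $ i) * (A *\<^sub>v w) $ i)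
      = (\<Sum>i<n. \<Sum>j<n. sgn (w $ i) * (A $$ (i, j) * w $ j))"
    by (auto simp: mult_mat_vec_index_sum[OF A' w] sum_distrib_left
        simp del: index_mult_mat_vec intro!: sum.cong)
  also have "\<dots> \<le> (\<Sum>i<n. \<Sum>j<n. A $$ (i, j) * \<bar>w $ j\<bar>)"
  proof (intro sum_mono)
    fix i j assume ij: "i \<in> {..<n}" "j \<in> {..<n}"
    show "sgn (w $ i) * (A $$ (i, j) * w $ j) \<le> A $$ (i, j) * \<bar>w $ j\<bar>"
    proof (cases "i = j")
      case True
      then show ?thesis by (simp add: abs_sgn mult.commute mult.left_commute)
    next
      case False
      have "sgn (w $ i) * w $ j \<le> \<bar>w $ j\<bar>" by (auto simp: sgn_if)
      moreover have "0 \<le> A $$ (i, j)" using A ij False by (simp add: generator_mat_def)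
      ultimately show ?thesis
        using mult_left_mono by (fastforce simp: mult.left_commute)
    qed
  qed
  also have "\<dots> = (\<Sum>j<n. (\<Sum>i<n. A $$ (i, j)) * \<bar>w $ j\<bar>)"
    by (subst sum.swap) (simp add: sum_distrib_right)
  also have "\<dots> = 0" using A by (simp add: generator_mat_def)
  finally show ?thesis .
qed

text \<open>Pair \<open>(I - \<tau> A) w\<close> with the signs of \<open>w\<close> and use dissipativity.\<close>

lemma norm1_le_norm1_resolvent_image:
  assumes A: "generator_mat n A" and "0 \<le> \<tau>" and w: "w \<in> carrier_vec n"
  shows "norm1_vec w \<le> norm1_vec ((1\<^sub>m n - \<tau> \<cdot>\<^sub>m A) *\<^sub>v w)"
proof -
  have A': "A \<in> carrier_mat n n" using A by (simp add: generator_mat_def)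
  let ?z = "(1\<^sub>m n - \<tau> \<cdot>\<^sub>m A) *\<^sub>v w"
  have z: "?z $ i = w $ i - \<tau> * (A *\<^sub>v w) $ i" if "i < n" for i
  proof -
    have "?z $ i = w $ i - ((\<tau> \<cdot>\<^sub>m A) *\<^sub>v w) $ i"
      using A' w that by (simp add: minus_mult_distrib_mat_vec[of _ n n])
    also have "((\<tau> \<cdot>\<^sub>m A) *\<^sub>v w) $ i = \<tau> * (A *\<^sub>v w) $ i"
      using A' w that by (simp add: scalar_prod_def sum_distrib_left mult.assoc)
    finally show ?thesis .
  qed
  have "norm1_vec w \<le> norm1_vec w - \<tau> * (\<Sum>i<n. sgn (w $ i) * (A *\<^sub>v w) $ i)"
    using mult_nonneg_nonpos[OF \<open>0 \<le> \<tau>\<close> generator_mat_dissipative[OF A w]] by linarith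
  also have "\<dots> = (\<Sum>i<n. sgn (w $ i) * (w $ i - \<tau> * (A *\<^sub>v w) $ i))"
    by (simp add: norm1_vec_carrier[OF w] sum_distrib_left sum_subtractf right_diff_distrib
        abs_sgn mult.commute mult.left_commute del: index_mult_mat_vec)
  also have "\<dots> = (\<Sum>i<n. sgn (w $ i) * ?z $ i)"
    by (intro sum.cong) (simp_all add: z del: index_mult_mat_vec)
  also have "\<dots> \<le> (\<Sum>i<n. \<bar>?z $ i\<bar>)"
    by (intro sum_mono) (auto simp: sgn_if)
  also have "\<dots> = norm1_vec ?z"
    using A' w by (subst norm1_vec_carrier[OF mult_mat_vec_carrier[of _ n n]]) auto
  finally show ?thesis .
qed

lemma det_resolvent_nonzero:
  assumes A: "generator_mat n A" and "0 \<le> \<tau>"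
  shows "det (1\<^sub>m n - \<tau> \<cdot>\<^sub>m A) \<noteq> 0"
proof
  assume "det (1\<^sub>m n - \<tau> \<cdot>\<^sub>m A) = 0"
  moreover have "1\<^sub>m n - \<tau> \<cdot>\<^sub>m A \<in> carrier_mat n n"
    using A by (auto simp: generator_mat_def)
  ultimately obtain w where w: "w \<in> carrier_vec n" "w \<noteq> 0\<^sub>v n"
    and 0: "(1\<^sub>m n - \<tau> \<cdot>\<^sub>m A) *\<^sub>v w = 0\<^sub>v n"
    using det_0_iff_vec_prod_zero by blast
  have "(\<Sum>i<n. \<bar>w $ i\<bar>) \<le> 0"
    using norm1_le_norm1_resolvent_image[OF A \<open>0 \<le> \<tau>\<close> w(1)]
    by (simp add: 0 norm1_vec_carrier[OF w(1)] norm1_vec_carrier[OF zero_carrier_vec])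
  then have "(\<Sum>i<n. \<bar>w $ i\<bar>) = 0"
    by (simp add: order_antisym sum_nonneg)
  then have "\<forall>i<n. w $ i = 0"
    by (simp add: sum_nonneg_eq_0_iff)
  then show False using w by (auto intro: eq_vecI)
qed

lemma mat_inverse_of_det_nonzero:
  fixes M :: "real mat"
  assumes M: "M \<in> carrier_mat n n" and "det M \<noteq> 0"
  obtains B where "mat_inverse M = Some B" "B \<in> carrier_mat n n" "M * B = 1\<^sub>m n" "B * M = 1\<^sub>m n"
proof -
  have "M \<in> Units (ring_mat TYPE(real) n ())"
    using assms by (rule det_non_zero_imp_unit)
  then obtain B where "mat_inverse M = Some B"
    using mat_inverse(1)[OF M] by fastforce
  then show thesis using that mat_inverse(2)[OF M] by blast
qed

lemma semi_implicit_step: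
  assumes A: "generator_mat n A" and "0 \<le> \<tau>" and u: "u \<in> carrier_vec n"
  defines "M \<equiv> 1\<^sub>m n - \<tau> \<cdot>\<^sub>m A"
  shows "invertible_mat M"
    and "the (mat_inverse M) *\<^sub>v u \<in> carrier_vec n"
    and "norm1_vec (the (mat_inverse M) *\<^sub>v u) \<le> norm1_vec u"
proof -
  have M: "M \<in> carrier_mat n n" using A by (auto simp: M_def generator_mat_def)
  have "det M \<noteq> 0" unfolding M_def using A \<open>0 \<le> \<tau>\<close> by (rule det_resolvent_nonzero)
  then obtain B where B: "mat_inverse M = Some B" "B \<in> carrier_mat n n"
    and inv: "M * B = 1\<^sub>m n" "B * M = 1\<^sub>m n"
    using M mat_inverse_of_det_nonzero by blast
  show "invertible_mat M"
    using M B(2) inv unfolding invertible_mat_def inverts_mat_def square_mat.simps by auto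
  show w: "the (mat_inverse M) *\<^sub>v u \<in> carrier_vec n" using B u by simp
  have "M *\<^sub>v (B *\<^sub>v u) = u"
    using assoc_mult_mat_vec[OF M B(2) u] inv u by simp
  then show "norm1_vec (the (mat_inverse M) *\<^sub>v u) \<le> norm1_vec u"
    using norm1_le_norm1_resolvent_image[OF A \<open>0 \<le> \<tau>\<close> w] B by (simp add: M_def)
qed

section \<open>The osmosis matrix is a generator\<close>

text \<open>
  Pixel coordinates are at least one, so the truncated subtraction in the neighbourhood relation is
  exact.
\<close>

lemma grid_neighbours_symmetric:
  assumes "bij_betw pix {..<mx * my} (grid_pixels mx my)" "i < mx * my" "j < mx * my"
  shows "j \<in> grid_neighbours mx my pix i \<longleftrightarrow> i \<in> grid_neighbours mx my pix j"
proof -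
  have "pix i \<in> {1..mx} \<times> {1..my}" "pix j \<in> {1..mx} \<times> {1..my}"
    using assms bij_betwE by (fastforce simp: grid_pixels_def)+
  moreover obtain x y x' y' where "pix i = (x, y)" "pix j = (x', y')"
    by (metis surj_pair)
  ultimately show ?thesis
    using assms(2,3) by (auto simp: grid_neighbours_def)
qed

lemma grid_neighbours_irreflexive:
  assumes "bij_betw pix {..<mx * my} (grid_pixels mx my)" "i < mx * my"
  shows "i \<notin> grid_neighbours mx my pix i"
proof -
  have "pix i \<in> {1..mx} \<times> {1..my}"
    using assms bij_betwE by (fastforce simp: grid_pixels_def)
  then show ?thesis by (auto simp: grid_neighbours_def)
qed

lemma diffusivity_nonneg:
  assumes "eps > 0"
  shows "0 \<le> diffusivity mx my pix h eps v u k"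
  using assms by (auto simp: diffusivity_def split: prod.splits)

lemma osmosis_matrix_generator:
  fixes v u :: "real vec"
  assumes pix: "bij_betw pix {..<mx * my} (grid_pixels mx my)"
    and eps: "eps > 0" and v: "\<forall>i<mx * my. v $ i > 0"
  shows "generator_mat (mx * my) (osmosis_matrix mx my pix h eps v u)"
proof -
  define n where "n = mx * my"
  define g where "g = diffusivity mx my pix h eps v u"
  define Nb where "Nb = grid_neighbours mx my pix"
  define B where "B = osmosis_matrix mx my pix h eps v u"
  define c where "c i j = (g j + g i) / (2 * h\<^sup>2) * (1 - (v $ j - v $ i) / (v $ j + v $ i))" for i j
  have B: "B \<in> carrier_mat n n"
    by (simp add: B_def n_def osmosis_matrix_def Let_def)
  have off: "B $$ (i, j) = (if j \<in> Nb i then c i j else 0)" if "i < n" "j < n" "i \<noteq> j" for i j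
    using that by (simp add: B_def n_def osmosis_matrix_def Let_def g_def Nb_def c_def)
  have diag: "B $$ (j, j) = - (\<Sum>i\<in>Nb j. c i j)" if "j < n" for j
  proof -
    have weight: "(g k + g j) / (2 * h\<^sup>2) * (- 1 - (v $ k - v $ j) / (v $ k + v $ j)) = - c k j" for k
    proof -
      have "(v $ k - v $ j) / (v $ k + v $ j) = - ((v $ j - v $ k) / (v $ j + v $ k))"
        by (metis add.commute minus_diff_eq minus_divide_left)
      moreover have "x * (- 1 - - y) = - (x * (1 - y))" for x y :: real
        by (simp add: right_diff_distrib)
      ultimately show ?thesis unfolding c_def by (simp only: add.commute)
    qed
    have "B $$ (j, j) =
        (\<Sum>k\<in>Nb j. (g k + g j) / (2 * h\<^sup>2) * (- 1 - (v $ k - v $ j) / (v $ k + v $ j)))"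
      using that by (simp add: B_def n_def osmosis_matrix_def Let_def g_def Nb_def)
    then show ?thesis unfolding weight by (simp add: sum_negf)
  qed
  have "0 \<le> c i j" if "i < n" "j < n" for i j
  proof -
    have "0 < v $ i" "0 < v $ j" using v that by (auto simp: n_def)
    then have "(v $ j - v $ i) / (v $ j + v $ i) \<le> 1" by simp
    moreover have "0 \<le> g i" "0 \<le> g j" by (auto simp: g_def diffusivity_nonneg[OF eps])
    ultimately show ?thesis by (simp add: c_def)
  qed
  then have "\<forall>i<n. \<forall>j<n. i \<noteq> j \<longrightarrow> 0 \<le> B $$ (i, j)" by (simp add: off)
  moreover have "(\<Sum>i<n. B $$ (i, j)) = 0" if j: "j < n" for j
  proof -
    have "(\<Sum>i\<in>{..<n} - {j}. B $$ (i, j)) = (\<Sum>i\<in>{..<n} - {j}. if i \<in> Nb j then c i j else 0)"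
      using j grid_neighbours_symmetric[OF pix]
      by (intro sum.cong) (auto simp: off Nb_def n_def)
    also have "\<dots> = (\<Sum>i\<in>({..<n} - {j}) \<inter> Nb j. c i j)"
      by (subst sum.inter_restrict) auto
    also have "({..<n} - {j}) \<inter> Nb j = Nb j"
    proof -
      have "Nb j \<subseteq> {..<n}" by (auto simp: Nb_def n_def grid_neighbours_def)
      moreover have "j \<notin> Nb j"
        using grid_neighbours_irreflexive[OF pix] j by (simp add: Nb_def n_def)
      ultimately show ?thesis by blast
    qed
    finally show ?thesis
      using sum.remove[of "{..<n}" j "\<lambda>i. B $$ (i, j)"] j diag[OF j] by simp
  qed
  ultimately show ?thesis using B by (simp add: generator_mat_def B_def n_def)
qed

section \<open>Stability of the two schemes\<close>

text \<open>
  If all diagonal entries vanish, the bound is \<open>1 / 0 = \<infinity>\<close> in the extended reals and the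
  restriction is void; the conclusion in product form covers this case.
\<close>

lemma time_step_restriction_diagonal:
  assumes "ereal \<tau> \<le> 1 / ereal (Max {\<bar>B $$ (i, i)\<bar> | i. i < n})" "0 \<le> \<tau>" "i < n"
  shows "\<tau> * \<bar>B $$ (i, i)\<bar> \<le> (1 :: real)"
proof -
  let ?S = "{\<bar>B $$ (i, i)\<bar> | i. i < n}"
  have le: "\<bar>B $$ (i, i)\<bar> \<le> Max ?S" using \<open>i < n\<close> by (intro Max_ge) auto
  have "\<tau> * Max ?S \<le> 1"
  proof (cases "Max ?S = 0")
    case False
    then have pos: "0 < Max ?S" using le by linarith
    then have "\<tau> \<le> 1 / Max ?S" using assms(1) by (simp add: one_ereal_def)
    then show ?thesis using pos by (simp add: pos_le_divide_eq)
  qed simp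
  then show ?thesis using mult_left_mono[OF le \<open>0 \<le> \<tau>\<close>] by linarith
qed

lemma stable_norm1_if_decreasing:
  assumes "u 0 = f" "\<And>k. norm1_vec (u (Suc k)) \<le> norm1_vec (u k)"
  shows "stable_norm1 f u"
proof -
  have "norm1_vec (u k) \<le> norm1_vec f" for k
    using assms by (induction k) (auto intro: order_trans)
  then show ?thesis by (simp add: stable_norm1_def)
qed

theorem theorem4p4:
  fixes mx my N :: nat and pix :: "nat \<Rightarrow> nat \<times> nat" and h eps :: real
    and v f :: "real vec" and A :: "real vec \<Rightarrow> real mat"
  assumes "mx \<ge> 1" and "my \<ge> 1" and "N = mx * my"
    and "bij_betw pix {..<N} (grid_pixels mx my)"
    and "h > 0" and "eps > 0"
    and "v \<in> carrier_vec N" and "\<forall>i<N. v $ i > 0"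
    and "f \<in> carrier_vec N" and "\<forall>i<N. f $ i > 0"
    and "A = osmosis_matrix mx my pix h eps v"
  shows "(\<forall>\<tau>>0.
            (\<forall>k. ereal \<tau> \<le> 1 / ereal (Max {\<bar>A (explicit_scheme N A \<tau> f k) $$ (i, i)\<bar> | i. i < N}))
            \<longrightarrow> stable_norm1 f (explicit_scheme N A \<tau> f))
       \<and> (\<forall>\<tau>>0.
            (\<forall>k. invertible_mat (1\<^sub>m N - \<tau> \<cdot>\<^sub>m A (semi_implicit_scheme N A \<tau> f k)))
            \<and> stable_norm1 f (semi_implicit_scheme N A \<tau> f))"
proof (intro conjI allI impI)
  have gen: "generator_mat N (A u)" for u
    using assms osmosis_matrix_generator by auto
  have carrier: "A u \<in> carrier_mat N N" for u
    using gen by (simp add: generator_mat_def)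
  fix \<tau> :: real assume "\<tau> > 0"
  then have \<tau>: "0 \<le> \<tau>" by simp
  {
    assume restriction: "\<forall>k. ereal \<tau> \<le>
      1 / ereal (Max {\<bar>A (explicit_scheme N A \<tau> f k) $$ (i, i)\<bar> | i. i < N})"
    have iterate: "explicit_scheme N A \<tau> f k \<in> carrier_vec N" for k
    proof (induction k)
      case 0
      then show ?case using assms(9) by simp
    next
      case (Suc k)
      have "1\<^sub>m N + \<tau> \<cdot>\<^sub>m A (explicit_scheme N A \<tau> f k) \<in> carrier_mat N N"
        using carrier by simp
      then show ?case using Suc by (simp only: explicit_scheme.simps mult_mat_vec_carrier)
    qed
    show "stable_norm1 f (explicit_scheme N A \<tau> f)"
    proof (rule stable_norm1_if_decreasing)
      fix k
      show "norm1_vec (explicit_scheme N A \<tau> f (Suc k)) \<le> norm1_vec (explicit_scheme N A \<tau> f k)"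
        unfolding explicit_scheme.simps
        by (rule explicit_step_contracts_norm1[OF gen \<tau> _ iterate])
          (rule time_step_restriction_diagonal[OF restriction[rule_format] \<tau>])
    qed simp
  }
  have iterate: "semi_implicit_scheme N A \<tau> f k \<in> carrier_vec N" for k
  proof (induction k)
    case 0
    then show ?case using assms(9) by simp
  next
    case (Suc k)
    then show ?case unfolding semi_implicit_scheme.simps by (rule semi_implicit_step(2)[OF gen \<tau>])
  qed
  show "invertible_mat (1\<^sub>m N - \<tau> \<cdot>\<^sub>m A (semi_implicit_scheme N A \<tau> f k))" for k
    by (rule semi_implicit_step(1)[OF gen \<tau> iterate])
  show "stable_norm1 f (semi_implicit_scheme N A \<tau> f)"
  proof (rule stable_norm1_if_decreasing)
    fix k
    show "norm1_vec (semi_implicit_scheme N A \<tau> f (Suc k))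
        \<le> norm1_vec (semi_implicit_scheme N A \<tau> f k)"
      unfolding semi_implicit_scheme.simps by (rule semi_implicit_step(3)[OF gen \<tau> iterate])
  qed simp
qed

end
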